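(* Let $X\in\mathbb{R}^{n\times p}$ be a centered data matrix with columns $X_1,\dots,X_p$, and let $a,k$ be positive integers with $a\le n$, $k\le p$. Consider the problem $$(P)\qquad \max_{s\in\{0,1\}^p,\;U\in\mathbb{R}^{n\times a}}\ \sum_{i=1}^p s_i\sum_{j=1}^a (X_i^TU_j)^2\quad\text{s.t.}\quad \sum_{i=1}^p s_i\le k,\ \ U^TU=I_a,$$ and, for $\eta\ge 0$, the problem $$(Q_\eta)\qquad \max_{s\in\{0,1\}^p}\ \sum_{i=1}^p s_i\|X_i\|^2\quad\text{s.t.}\quad \sum_{i=1}^p s_i\le k,\ \ \text{and for all }\sigma\subset[p]:\ \eta(s^\sigma)>\eta\ \Rightarrow\ \sum_{i\in\sigma}s_i\le|\sigma|-1 .$$ Let $s^o$ be an optimal solution of $(P)$. Then there exists $\delta>0$ such that for every $\eta\in[\eta(s^o),\eta(s^o)+\delta]$, every optimal solution of $(Q_\eta)$ is an optimal solution of $(P)$.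
   Context: $[p]=\{1,\dots,p\}$. For $\sigma\subset[p]$, $s^\sigma\in\{0,1\}^p$ is the indicator vector of $\sigma$. For $s\in\{0,1\}^p$, $X(s)$ is the matrix obtained from $X$ by deleting every column $X_i$ with $s_i=0$ (empty matrix of norm $0$ if $s=0$). $U[s]$ is any element of $\operatorname{argmax}\{\mathrm{tr}(U^TX(s)X(s)^TU): U\in\mathbb{R}^{n\times a},\ U^TU=I_a\}$, and $\eta(s)=\|X(s)-U[s]U[s]^TX(s)\|_F^2$, with $\|\cdot\|_F$ the Frobenius norm. A vector $s\in\{0,1\}^p$ is called an optimal solution of $(P)$ if $(s,U[s])$ is optimal for $(P)$. Centered means that each column of $X$ sums to zero. *)

theory Defs
  imports Complex_Main "Jordan_Normal_Form.DL_Submatrix"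
begin

text \<open>Columns and entries are indexed from \<open>0\<close>, so the index set \<open>[p]\<close> is \<^term>\<open>{..<p}\<close>.\<close>

definition vec_norm :: "real vec \<Rightarrow> real" where
  "vec_norm v = sqrt (v \<bullet> v)"

definition frob_norm :: "real mat \<Rightarrow> real" where
  "frob_norm A = sqrt (\<Sum>i<dim_row A. \<Sum>j<dim_col A. (A $$ (i, j))\<^sup>2)"

definition mat_trace :: "real mat \<Rightarrow> real" where
  "mat_trace A = (\<Sum>i<dim_row A. A $$ (i, i))"

definition centered :: "real mat \<Rightarrow> bool" where
  "centered X \<longleftrightarrow> (\<forall>j<dim_col X. (\<Sum>i<dim_row X. X $$ (i, j)) = 0)"

definition binary_vecs :: "nat \<Rightarrow> real vec set" where
  "binary_vecs p = {s \<in> carrier_vec p. \<forall>i<p. s $ i \<in> {0, 1}}"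

definition indicator_vec :: "nat \<Rightarrow> nat set \<Rightarrow> real vec" where
  "indicator_vec p \<sigma> = vec p (\<lambda>i. if i \<in> \<sigma> then 1 else 0)"

definition orthonormal_mats :: "nat \<Rightarrow> nat \<Rightarrow> real mat set" where
  "orthonormal_mats n a = {U \<in> carrier_mat n a. transpose_mat U * U = 1\<^sub>m a}"

text \<open>The matrix \<open>X(s)\<close>: it has \<open>0\<close> columns, hence Frobenius norm \<open>0\<close>, if \<open>s = 0\<close>.\<close>

definition select_cols :: "real mat \<Rightarrow> real vec \<Rightarrow> real mat" where
  "select_cols X s = submatrix X UNIV {i. i < dim_vec s \<and> s $ i \<noteq> 0}"

text \<open>\<open>is_best_basis X a s U\<close>: the matrix \<open>U\<close> is an admissible value of \<open>U[s]\<close>.\<close>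

definition is_best_basis :: "real mat \<Rightarrow> nat \<Rightarrow> real vec \<Rightarrow> real mat \<Rightarrow> bool" where
  "is_best_basis X a s =
     is_arg_max
       (\<lambda>U. mat_trace (transpose_mat U * (select_cols X s * transpose_mat (select_cols X s)) * U))
       (\<lambda>U. U \<in> orthonormal_mats (dim_row X) a)"

text \<open>In the following definitions \<open>V\<close> is the map taking \<open>s\<close> to the chosen \<open>U[s]\<close>.\<close>

definition eta :: "real mat \<Rightarrow> (real vec \<Rightarrow> real mat) \<Rightarrow> real vec \<Rightarrow> real" where
  "eta X V s =
     (frob_norm (select_cols X s - V s * transpose_mat (V s) * select_cols X s))\<^sup>2"

definition P_objective :: "real mat \<Rightarrow> nat \<Rightarrow> real vec \<times> real mat \<Rightarrow> real" where
  "P_objective X a =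
     (\<lambda>(s, U). \<Sum>i<dim_col X. s $ i * (\<Sum>j<a. (col X i \<bullet> col U j)\<^sup>2))"

definition P_feasible :: "real mat \<Rightarrow> nat \<Rightarrow> nat \<Rightarrow> real vec \<times> real mat \<Rightarrow> bool" where
  "P_feasible X a k =
     (\<lambda>(s, U). s \<in> binary_vecs (dim_col X) \<and> U \<in> orthonormal_mats (dim_row X) a
        \<and> (\<Sum>i<dim_col X. s $ i) \<le> real k)"

definition P_optimal ::
    "real mat \<Rightarrow> nat \<Rightarrow> nat \<Rightarrow> (real vec \<Rightarrow> real mat) \<Rightarrow> real vec \<Rightarrow> bool" where
  "P_optimal X a k V s \<longleftrightarrow> is_arg_max (P_objective X a) (P_feasible X a k) (s, V s)"

definition Q_objective :: "real mat \<Rightarrow> real vec \<Rightarrow> real" where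
  "Q_objective X s = (\<Sum>i<dim_col X. s $ i * (vec_norm (col X i))\<^sup>2)"

definition Q_feasible ::
    "real mat \<Rightarrow> nat \<Rightarrow> (real vec \<Rightarrow> real mat) \<Rightarrow> real \<Rightarrow> real vec \<Rightarrow> bool" where
  "Q_feasible X k V \<eta> s \<longleftrightarrow>
     s \<in> binary_vecs (dim_col X) \<and> (\<Sum>i<dim_col X. s $ i) \<le> real k \<and>
     (\<forall>\<sigma> \<subseteq> {..<dim_col X}. eta X V (indicator_vec (dim_col X) \<sigma>) > \<eta> \<longrightarrow>
        (\<Sum>i\<in>\<sigma>. s $ i) \<le> real (card \<sigma>) - 1)"

definition Q_optimal ::
    "real mat \<Rightarrow> nat \<Rightarrow> (real vec \<Rightarrow> real mat) \<Rightarrow> real \<Rightarrow> real vec \<Rightarrow> bool" where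
  "Q_optimal X k V \<eta> = is_arg_max (Q_objective X) (Q_feasible X k V \<eta>)"

end

theory Submission
  imports Defs
begin

text \<open>
  By Pythagoras, \<open>\<eta>(s)\<close> is the objective of \<open>(Q\<^sub>\<eta>)\<close> at \<open>s\<close> minus the objective of \<open>(P)\<close> at
  \<open>(s, U[s])\<close>, so it is the minimum over \<open>U\<close> of a sum of nonnegative terms, one for each column in the
  support of \<open>s\<close>. Hence \<open>\<sigma> \<mapsto> \<eta>(s\<^sup>\<sigma>)\<close> is monotone, and the constraints of \<open>(Q\<^sub>\<eta>)\<close> amount to
  \<open>\<eta>(s) \<le> \<eta>\<close>. There are finitely many values \<open>\<eta>(s)\<close>, so for small \<open>\<delta>\<close> a feasible \<open>s\<close> of \<open>(Q\<^sub>\<eta>)\<close>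
  satisfies \<open>\<eta>(s) \<le> \<eta>(s\<^sup>o)\<close>. An optimal \<open>s\<close> of \<open>(Q\<^sub>\<eta>)\<close> is then at least as good as \<open>s\<^sup>o\<close> in both
  terms of the difference.
\<close>

section \<open>Norms and traces, column by column\<close>

text \<open>The inverse sends an element of \<open>S\<close> to the number of smaller elements of
  \<open>S\<close>. This turns sums over the columns of a submatrix into sums over the selected
  indices.\<close>

lemma bij_betw_pick:
  assumes "finite S"
  shows "bij_betw (pick S) {..<card S} S"
proof (rule bij_betw_byWitness[where f' = "\<lambda>i. card {a\<in>S. a < i}"])
  show "(\<lambda>i. card {a \<in> S. a < i}) ` S \<subseteq> {..<card S}"
    using assms by (auto intro!: psubset_card_mono)
qed (auto simp: card_pick_le pick_card_in_set pick_in_set_le)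

lemma orthonormal_mats_carrier: "U \<in> orthonormal_mats n a \<Longrightarrow> U \<in> carrier_mat n a"
  by (simp add: orthonormal_mats_def)

lemma scalar_prod_self_eq_sum: "(v :: real vec) \<bullet> v = (\<Sum>j<dim_vec v. (v $ j)\<^sup>2)"
  by (simp add: scalar_prod_def power2_eq_square lessThan_atLeast0)

text \<open>Pythagoras: for \<open>w = transpose_mat U *\<^sub>v x\<close>, orthonormality makes
  both the cross term with \<open>x\<close> and the squared norm of \<open>U *\<^sub>v w\<close>
  equal to \<open>w \<bullet> w\<close>, and the entries of \<open>w\<close> are the products of
  \<open>x\<close> with the columns of \<open>U\<close>.\<close>

lemma norm_projection_residual:
  assumes U: "U \<in> orthonormal_mats n a" and x: "x \<in> carrier_vec n"
  shows "(x - U *\<^sub>v (transpose_mat U *\<^sub>v x)) \<bullet> (x - U *\<^sub>v (transpose_mat U *\<^sub>v x))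
    = x \<bullet> x - (\<Sum>j<a. (x \<bullet> col U j)\<^sup>2)"
proof -
  define w where "w = transpose_mat U *\<^sub>v x"
  have Uc: "U \<in> carrier_mat n a" and UU: "transpose_mat U * U = 1\<^sub>m a"
    using U by (auto simp: orthonormal_mats_def)
  have w: "w \<in> carrier_vec a" using Uc x by (simp add: w_def)
  have Uw: "U *\<^sub>v w \<in> carrier_vec n" using Uc w by simp
  have xUw: "x \<bullet> (U *\<^sub>v w) = w \<bullet> w"
    using transpose_vec_mult_scalar[OF Uc w x] by (simp add: w_def)
  have "transpose_mat U *\<^sub>v (U *\<^sub>v w) = w"
    using UU Uc w assoc_mult_mat_vec[of "transpose_mat U" a n U a w] by simp
  then have UwUw: "(U *\<^sub>v w) \<bullet> (U *\<^sub>v w) = w \<bullet> w"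
    using transpose_vec_mult_scalar[OF Uc w Uw] by simp
  have "w \<bullet> w = (\<Sum>j<a. (x \<bullet> col U j)\<^sup>2)"
    unfolding scalar_prod_self_eq_sum
  proof (rule sum.cong)
    fix j assume "j \<in> {..<a}"
    then show "(w $ j)\<^sup>2 = (x \<bullet> col U j)\<^sup>2"
      using Uc x by (simp add: w_def comm_scalar_prod[of "col U j" n x])
  qed (use w in simp)
  moreover have "(x - U *\<^sub>v w) \<bullet> (x - U *\<^sub>v w) = x \<bullet> x - w \<bullet> w"
    using x Uw xUw UwUw comm_scalar_prod[OF Uw x]
    by (simp add: minus_scalar_prod_distrib[of _ n] scalar_prod_minus_distrib[of _ n])
  ultimately show ?thesis by (simp add: w_def)
qed

lemma frob_norm_sq_eq_sum_cols: "(frob_norm A)\<^sup>2 = (\<Sum>j<dim_col A. col A j \<bullet> col A j)"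
proof -
  have "(frob_norm A)\<^sup>2 = (\<Sum>i<dim_row A. \<Sum>j<dim_col A. (A $$ (i, j))\<^sup>2)"
    by (simp add: frob_norm_def sum_nonneg)
  also have "\<dots> = (\<Sum>j<dim_col A. \<Sum>i<dim_row A. (A $$ (i, j))\<^sup>2)"
    by (rule sum.swap)
  finally show ?thesis by (simp add: scalar_prod_self_eq_sum)
qed

text \<open>Projection acts on each column separately, so Pythagoras applies column by
  column.\<close>

lemma frob_norm_residual:
  assumes U: "U \<in> orthonormal_mats (dim_row A) a"
  shows "(frob_norm (A - U * transpose_mat U * A))\<^sup>2
    = (\<Sum>c<dim_col A. col A c \<bullet> col A c - (\<Sum>j<a. (col A c \<bullet> col U j)\<^sup>2))"
proof -
  let ?R = "A - U * transpose_mat U * A"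
  have Uc: "U \<in> carrier_mat (dim_row A) a" using U by (rule orthonormal_mats_carrier)
  have "col ?R c = col A c - U *\<^sub>v (transpose_mat U *\<^sub>v col A c)" if "c < dim_col A" for c
  proof -
    have UtU: "U * transpose_mat U \<in> carrier_mat (dim_row A) (dim_row A)" using Uc by simp
    have "col ?R c = col A c - col (U * transpose_mat U * A) c"
      using that Uc by (intro eq_vecI) auto
    also have "col (U * transpose_mat U * A) c = (U * transpose_mat U) *\<^sub>v col A c"
      using that by (intro col_mult2[OF UtU]) auto
    also have "\<dots> = U *\<^sub>v (transpose_mat U *\<^sub>v col A c)"
      using Uc by (intro assoc_mult_mat_vec) auto
    finally show ?thesis .
  qed
  then have "col ?R c \<bullet> col ?R c = col A c \<bullet> col A c - (\<Sum>j<a. (col A c \<bullet> col U j)\<^sup>2)"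
    if "c < dim_col A" for c
    using norm_projection_residual[OF U, of "col A c"] that by simp
  then show ?thesis
    unfolding frob_norm_sq_eq_sum_cols using Uc by simp
qed

text \<open>With \<open>B = transpose_mat A * U\<close> the matrix is
  \<open>transpose_mat B * B\<close>, whose diagonal holds the squared norms of the columns of
  \<open>B\<close>.\<close>

lemma trace_quadratic_eq_sum:
  assumes U: "U \<in> carrier_mat (dim_row A) a"
  shows "mat_trace (transpose_mat U * (A * transpose_mat A) * U)
    = (\<Sum>c<dim_col A. \<Sum>j<a. (col A c \<bullet> col U j)\<^sup>2)"
proof -
  let ?B = "transpose_mat A * U"
  have B: "?B \<in> carrier_mat (dim_col A) a"
    using U by (intro mult_carrier_mat[of _ _ "dim_row A"]) auto
  have "transpose_mat U * (A * transpose_mat A) * U = transpose_mat U * (A * transpose_mat A * U)"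
    using U by (intro assoc_mult_mat) auto
  also have "A * transpose_mat A * U = A * ?B"
    using U by (intro assoc_mult_mat) auto
  also have "transpose_mat U * (A * ?B) = transpose_mat U * A * ?B"
    using U B by (intro assoc_mult_mat[symmetric]) auto
  also have "transpose_mat U * A = transpose_mat ?B"
    using U by (simp add: transpose_mult[of _ "dim_col A" "dim_row A"])
  finally have "mat_trace (transpose_mat U * (A * transpose_mat A) * U)
      = (\<Sum>j<a. col ?B j \<bullet> col ?B j)"
    using U by (simp add: mat_trace_def)
  also have "\<dots> = (\<Sum>j<a. \<Sum>c<dim_col A. (col A c \<bullet> col U j)\<^sup>2)"
    using U by (simp add: scalar_prod_self_eq_sum)
  also have "\<dots> = (\<Sum>c<dim_col A. \<Sum>j<a. (col A c \<bullet> col U j)\<^sup>2)"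
    by (rule sum.swap)
  finally show ?thesis .
qed

section \<open>Sums over the selected columns\<close>

lemma dim_row_select_cols [simp]: "dim_row (select_cols X s) = dim_row X"
  by (simp add: select_cols_def dim_submatrix)

text \<open>Since \<open>s\<close> is binary, its entries act as weights that keep exactly the
  selected columns. The function \<phi> is arbitrary because both the residual and the trace need
  this transfer.\<close>

lemma sum_cols_select_cols:
  fixes \<phi> :: "real vec \<Rightarrow> real"
  assumes s: "s \<in> binary_vecs (dim_col X)"
  shows "(\<Sum>c<dim_col (select_cols X s). \<phi> (col (select_cols X s) c))
    = (\<Sum>i<dim_col X. s $ i * \<phi> (col X i))"
proof -
  define J where "J = {i. i < dim_vec s \<and> s $ i \<noteq> 0}"
  have dim_s: "dim_vec s = dim_col X" and s01: "i < dim_col X \<Longrightarrow> s $ i = 0 \<or> s $ i = 1" for i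
    using s by (auto simp: binary_vecs_def)
  have J_sub: "J \<subseteq> {..<dim_col X}" by (auto simp: J_def dim_s)
  then have finJ: "finite J" by (rule finite_subset) simp
  have J_eq: "{j. j < dim_col X \<and> j \<in> J} = J" using J_sub by auto
  have dim: "dim_col (select_cols X s) = card J"
    unfolding select_cols_def dim_submatrix J_def[symmetric] J_eq ..
  have pickJ: "pick J c < dim_col X" if "c < card J" for c
    using pick_in_set_le[OF that] J_sub by auto
  have col: "col (select_cols X s) c = col X (pick J c)" if "c < card J" for c
    using that pickJ[OF that] dim
    by (intro eq_vecI)
      (auto simp: select_cols_def J_def[symmetric] submatrix_index J_eq pick_UNIV dim_submatrix)
  have "(\<Sum>c<dim_col (select_cols X s). \<phi> (col (select_cols X s) c))
      = (\<Sum>c<card J. \<phi> (col X (pick J c)))"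
    by (simp add: dim col)
  also have "\<dots> = (\<Sum>i\<in>J. \<phi> (col X i))"
    by (rule sum.reindex_bij_betw[OF bij_betw_pick[OF finJ]])
  also have "\<dots> = (\<Sum>i\<in>J. s $ i * \<phi> (col X i))"
    using s01 J_sub by (intro sum.cong) (auto simp: J_def)
  also have "\<dots> = (\<Sum>i<dim_col X. s $ i * \<phi> (col X i))"
    using J_sub by (intro sum.mono_neutral_left) (auto simp: J_def dim_s)
  finally show ?thesis .
qed

section \<open>Residuals and monotonicity of \<open>eta\<close>\<close>

text \<open>For orthonormal \<open>U\<close> this is the squared distance of column \<open>i\<close>
  from the column span of \<open>U\<close>.\<close>

definition col_residual :: "real mat \<Rightarrow> nat \<Rightarrow> real mat \<Rightarrow> nat \<Rightarrow> real" where
  "col_residual X a U i = col X i \<bullet> col X i - (\<Sum>j<a. (col X i \<bullet> col U j)\<^sup>2)"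

lemma col_residual_nonneg:
  assumes "U \<in> orthonormal_mats (dim_row X) a"
  shows "0 \<le> col_residual X a U i"
  unfolding col_residual_def norm_projection_residual[OF assms col_dim, symmetric]
  by (simp only: scalar_prod_self_eq_sum sum_nonneg zero_le_power2)

lemma sum_residual_eq:
  "(\<Sum>i<dim_col X. s $ i * col_residual X a U i) = Q_objective X s - P_objective X a (s, U)"
proof -
  have "(vec_norm v)\<^sup>2 = v \<bullet> v" for v
    by (simp add: vec_norm_def scalar_prod_self_eq_sum sum_nonneg)
  then show ?thesis
    by (simp add: Q_objective_def P_objective_def col_residual_def right_diff_distrib sum_subtractf)
qed

lemma eta_eq_sum_residual:
  assumes s: "s \<in> binary_vecs (dim_col X)" and V: "V s \<in> orthonormal_mats (dim_row X) a"
  shows "eta X V s = (\<Sum>i<dim_col X. s $ i * col_residual X a (V s) i)"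
  using frob_norm_residual[of "V s" "select_cols X s" a] V
    sum_cols_select_cols[OF s, of "\<lambda>x. x \<bullet> x - (\<Sum>j<a. (x \<bullet> col (V s) j)\<^sup>2)"]
  by (simp add: eta_def col_residual_def)

lemma best_basis_orthonormal:
  "is_best_basis X a s U \<Longrightarrow> U \<in> orthonormal_mats (dim_row X) a"
  by (simp add: is_best_basis_def is_arg_max_def)

text \<open>For fixed \<open>s\<close>, the trace that defines the best basis is the objective of
  (P) as a function of \<open>U\<close>.\<close>

lemma best_basis_maximizes_P_objective:
  assumes s: "s \<in> binary_vecs (dim_col X)" and V: "is_best_basis X a s V"
    and U: "U \<in> orthonormal_mats (dim_row X) a"
  shows "P_objective X a (s, U) \<le> P_objective X a (s, V)"
proof -
  have "mat_trace (transpose_mat W * (select_cols X s * transpose_mat (select_cols X s)) * W)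
      = P_objective X a (s, W)" if "W \<in> orthonormal_mats (dim_row X) a" for W
    using trace_quadratic_eq_sum[of W "select_cols X s" a] orthonormal_mats_carrier[OF that]
      sum_cols_select_cols[OF s, of "\<lambda>x. \<Sum>j<a. (x \<bullet> col W j)\<^sup>2"]
    by (simp add: P_objective_def)
  then show ?thesis
    using V U by (auto simp: is_best_basis_def is_arg_max_linorder)
qed

text \<open>The basis \<open>V t\<close> is a competitor for \<open>s\<close>, so its residual sum
  over \<open>s\<close> bounds \<open>eta X V s\<close> from above. Passing from \<open>s\<close> to
  \<open>t\<close> only adds nonnegative residuals.\<close>

lemma eta_mono:
  assumes V: "\<And>s. s \<in> binary_vecs (dim_col X) \<Longrightarrow> is_best_basis X a s (V s)"
    and s: "s \<in> binary_vecs (dim_col X)" and t: "t \<in> binary_vecs (dim_col X)"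
    and le: "\<And>i. i < dim_col X \<Longrightarrow> s $ i \<le> t $ i"
  shows "eta X V s \<le> eta X V t"
proof -
  have Vs: "V s \<in> orthonormal_mats (dim_row X) a" and Vt: "V t \<in> orthonormal_mats (dim_row X) a"
    using V s t by (auto intro: best_basis_orthonormal)
  have "eta X V s = Q_objective X s - P_objective X a (s, V s)"
    by (simp only: eta_eq_sum_residual[of _ _ V, OF s Vs] sum_residual_eq)
  also have "\<dots> \<le> Q_objective X s - P_objective X a (s, V t)"
    using best_basis_maximizes_P_objective[OF s V[OF s] Vt] by simp
  also have "\<dots> = (\<Sum>i<dim_col X. s $ i * col_residual X a (V t) i)"
    by (simp only: sum_residual_eq)
  also have "\<dots> \<le> (\<Sum>i<dim_col X. t $ i * col_residual X a (V t) i)"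
    using le col_residual_nonneg[OF Vt] by (intro sum_mono mult_right_mono) auto
  also have "\<dots> = eta X V t"
    by (simp only: eta_eq_sum_residual[of _ _ V, OF t Vt])
  finally show ?thesis .
qed

section \<open>Binary vectors and the constraints of (Q)\<close>

lemma indicator_vec_binary [simp]: "indicator_vec p \<sigma> \<in> binary_vecs p"
  by (auto simp: indicator_vec_def binary_vecs_def)

lemma binary_vec_eq_indicator:
  assumes "s \<in> binary_vecs p"
  shows "s = indicator_vec p {i. i < p \<and> s $ i = 1}"
  using assms by (intro eq_vecI) (auto simp: indicator_vec_def binary_vecs_def)

lemma finite_binary_vecs: "finite (binary_vecs p)"
proof (rule finite_subset)
  show "binary_vecs p \<subseteq> indicator_vec p ` Pow {..<p}"
  proof
    fix s assume "s \<in> binary_vecs p"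
    from binary_vec_eq_indicator[OF this] show "s \<in> indicator_vec p ` Pow {..<p}"
      by (rule image_eqI) auto
  qed
qed simp

text \<open>Forward, the constraint for the support of \<open>s\<close> would be violated by
  \<open>s\<close> itself, so the support cannot have residual above \<eta>. Backward, monotonicity
  forces \<open>s\<close> to vanish somewhere on each \<sigma> with residual above \<eta>.\<close>

lemma Q_feasible_iff:
  assumes V: "\<And>s. s \<in> binary_vecs (dim_col X) \<Longrightarrow> is_best_basis X a s (V s)"
  shows "Q_feasible X k V \<eta> s \<longleftrightarrow>
    s \<in> binary_vecs (dim_col X) \<and> (\<Sum>i<dim_col X. s $ i) \<le> real k \<and> eta X V s \<le> \<eta>"
    (is "_ \<longleftrightarrow> ?R")
proof
  assume Q: "Q_feasible X k V \<eta> s"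
  define \<sigma> where "\<sigma> = {i. i < dim_col X \<and> s $ i = 1}"
  have s: "s \<in> binary_vecs (dim_col X)" using Q by (simp add: Q_feasible_def)
  have "(\<Sum>i\<in>\<sigma>. s $ i) = real (card \<sigma>)" by (simp add: \<sigma>_def)
  moreover have "\<sigma> \<subseteq> {..<dim_col X}" by (auto simp: \<sigma>_def)
  moreover have "eta X V (indicator_vec (dim_col X) \<sigma>) > \<eta> \<Longrightarrow> \<sigma> \<subseteq> {..<dim_col X} \<Longrightarrow>
      (\<Sum>i\<in>\<sigma>. s $ i) \<le> real (card \<sigma>) - 1"
    using Q unfolding Q_feasible_def by blast
  ultimately have "\<not> eta X V (indicator_vec (dim_col X) \<sigma>) > \<eta>"
    by linarith
  then show ?R
    using Q binary_vec_eq_indicator[OF s, folded \<sigma>_def, symmetric] by (simp add: Q_feasible_def)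
next
  assume R: ?R
  then have s01: "i < dim_col X \<Longrightarrow> s $ i = 0 \<or> s $ i = 1" for i
    by (auto simp: binary_vecs_def)
  have "(\<Sum>i\<in>\<sigma>. s $ i) \<le> real (card \<sigma>) - 1"
    if \<sigma>: "\<sigma> \<subseteq> {..<dim_col X}" and viol: "eta X V (indicator_vec (dim_col X) \<sigma>) > \<eta>" for \<sigma>
  proof -
    have "\<exists>i\<in>\<sigma>. s $ i = 0"
    proof (rule ccontr)
      assume "\<not> (\<exists>i\<in>\<sigma>. s $ i = 0)"
      then have "s $ i = 1" if "i \<in> \<sigma>" for i
        using s01 \<sigma> that by blast
      then have "indicator_vec (dim_col X) \<sigma> $ i \<le> s $ i" if "i < dim_col X" for i
        using s01[OF that] that by (auto simp: indicator_vec_def)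
      then have "eta X V (indicator_vec (dim_col X) \<sigma>) \<le> eta X V s"
        using R by (intro eta_mono[of X a V, OF V]) auto
      then show False using R viol by simp
    qed
    then obtain i where i: "i \<in> \<sigma>" "s $ i = 0" by blast
    have fin: "finite \<sigma>" using \<sigma> by (rule finite_subset) simp
    \<comment> \<open>The single zero entry at \<open>i\<close> accounts for the \<open>- 1\<close>
      in the bound; all other entries are at most 1.\<close>
    have "(\<Sum>j\<in>\<sigma>. s $ j) = (\<Sum>j\<in>\<sigma> - {i}. s $ j)"
      using i fin by (simp add: sum.remove)
    also have "\<dots> \<le> (\<Sum>j\<in>\<sigma> - {i}. 1)"
      using s01 \<sigma> by (intro sum_mono) (metis DiffD1 lessThan_iff order_refl subsetD zero_le_one)
    also have "\<dots> = real (card \<sigma>) - 1"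
      using card.remove[OF fin i(1)] by simp
    finally show ?thesis .
  qed
  with R show "Q_feasible X k V \<eta> s" unfolding Q_feasible_def by blast
qed

section \<open>The choice of \<delta> and the comparison of optima\<close>

lemma finite_gap_above:
  fixes c :: real
  assumes "finite A"
  shows "\<exists>\<delta>>0. \<forall>x\<in>A. x \<le> c + \<delta> \<longrightarrow> x \<le> c"
  using assms
proof induction
  case empty
  show ?case by (auto intro: exI[of _ 1])
next
  case (insert x A)
  then obtain \<delta> where \<delta>: "\<delta> > 0" "\<forall>y\<in>A. y \<le> c + \<delta> \<longrightarrow> y \<le> c" by blast
  show ?case
  proof (cases "x \<le> c")
    case True
    with \<delta> show ?thesis by auto
  next
    case False
    \<comment> \<open>Half the distance from \<open>c\<close> to \<open>x\<close> keeps
      \<open>c + \<delta>\<close> strictly below \<open>x\<close>, so the implication for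
      \<open>x\<close> holds vacuously.\<close>
    then show ?thesis
      using \<delta> by (intro exI[of _ "min \<delta> ((x - c) / 2)"]) (auto simp: min_def field_simps)
  qed
qed

theorem theorem4:
  fixes X :: "real mat" and n p a k :: nat
    and V :: "real vec \<Rightarrow> real mat" and s\<^sub>o :: "real vec"
  assumes "X \<in> carrier_mat n p" and "centered X"
    and "0 < a" and "a \<le> n" and "0 < k" and "k \<le> p"
    and "\<And>s. s \<in> binary_vecs p \<Longrightarrow> is_best_basis X a s (V s)"
    and "P_optimal X a k V s\<^sub>o"
  shows "\<exists>\<delta>>0. \<forall>\<eta>\<in>{eta X V s\<^sub>o..eta X V s\<^sub>o + \<delta>}. \<forall>s.
           Q_optimal X k V \<eta> s \<longrightarrow> P_optimal X a k V s"
proof -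
  have V: "is_best_basis X a s (V s)" if "s \<in> binary_vecs (dim_col X)" for s
    using assms(1,7) that by auto
  have eta_eq: "eta X V s = Q_objective X s - P_objective X a (s, V s)"
    if s: "s \<in> binary_vecs (dim_col X)" for s
    using eta_eq_sum_residual[of _ _ V, OF s best_basis_orthonormal[OF V[OF s]]]
    by (simp only: sum_residual_eq)
  have feas: "P_feasible X a k (s\<^sub>o, V s\<^sub>o)"
    and opt: "\<And>y. P_feasible X a k y \<Longrightarrow> P_objective X a y \<le> P_objective X a (s\<^sub>o, V s\<^sub>o)"
    using assms(8) by (auto simp: P_optimal_def is_arg_max_linorder)
  have so: "s\<^sub>o \<in> binary_vecs (dim_col X)" and so_k: "(\<Sum>i<dim_col X. s\<^sub>o $ i) \<le> real k"
    using feas by (auto simp: P_feasible_def)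
  \<comment> \<open>The gap is taken over the values of \<open>eta\<close> at all binary vectors, so
    one \<delta> serves every \<eta> in the interval.\<close>
  obtain \<delta> where "\<delta> > 0"
    and gap: "\<forall>x\<in>eta X V ` binary_vecs (dim_col X). x \<le> eta X V s\<^sub>o + \<delta> \<longrightarrow> x \<le> eta X V s\<^sub>o"
    using finite_gap_above[OF finite_imageI[OF finite_binary_vecs]] by blast
  have "P_optimal X a k V s"
    if \<eta>: "\<eta> \<in> {eta X V s\<^sub>o..eta X V s\<^sub>o + \<delta>}" and Q: "Q_optimal X k V \<eta> s" for \<eta> s
  proof -
    have Qf: "Q_feasible X k V \<eta> s"
      and Qmax: "\<And>t. Q_feasible X k V \<eta> t \<Longrightarrow> Q_objective X t \<le> Q_objective X s"
      using Q by (auto simp: Q_optimal_def is_arg_max_linorder)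
    have s: "s \<in> binary_vecs (dim_col X)" and s_k: "(\<Sum>i<dim_col X. s $ i) \<le> real k"
      and "eta X V s \<le> \<eta>"
      using Qf Q_feasible_iff[of X a V, OF V] by auto
    then have "eta X V s \<le> eta X V s\<^sub>o"
      using gap \<eta> by auto
    \<comment> \<open>The lower end of the interval makes \<open>s\<^sub>o\<close> feasible for (Q),
      hence a competitor of \<open>s\<close>.\<close>
    moreover have "Q_objective X s\<^sub>o \<le> Q_objective X s"
      using so so_k \<eta> Q_feasible_iff[of X a V, OF V] by (intro Qmax) auto
    \<comment> \<open>The objective of (P) is that of (Q) minus \<open>eta\<close>: the first is no
      smaller at \<open>s\<close> and the second no larger.\<close>
    ultimately have "P_objective X a (s\<^sub>o, V s\<^sub>o) \<le> P_objective X a (s, V s)"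
      using eta_eq[OF s] eta_eq[OF so] by simp
    moreover have "P_feasible X a k (s, V s)"
      using s s_k best_basis_orthonormal[OF V[OF s]] by (simp add: P_feasible_def)
    ultimately show ?thesis
      using opt by (auto simp: P_optimal_def is_arg_max_linorder intro: order_trans)
  qed
  with \<open>\<delta> > 0\<close> show ?thesis by blast
qed

end
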